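(* A complex time integral curve of the holomorphic vector field $X$ on $S_{\mathrm{reg}}$, which is a (complex time) reparametrization of a real time integral curve of $X$, is a geodesic on $(S_{\mathrm{reg}},\Gamma)$. Explicitly: let $\varphi:\Omega\rightarrow S_{\mathrm{reg}}$ be a holomorphic integral curve of $X$ defined on a connected open set $\Omega\subseteq\mathbb{C}$ (that is, $\varphi'(w)=X(\varphi(w))$ for all $w\in\Omega$), let $\alpha\in\mathbb{C}\setminus\{0\}$, $w_0\in\mathbb{C}$, and let $I\subseteq\mathbb{R}$ be an open interval with $\alpha t+w_0\in\Omega$ for all $t\in I$. Then the curve $I\rightarrow S_{\mathrm{reg}}: t\mapsto\varphi(\alpha t+w_0)$ is a geodesic of $(S_{\mathrm{reg}},\Gamma)$.
   Context: Let $a=2\cos\frac{2\pi}{5}$, $b=2\cos\frac{\pi}{5}$ (so $0<a<b$), and $f(\xi)=\xi^{8}(\xi-a)^{3}(\xi-b)^{9}$. Let $S=\{(\xi,\eta)\in\mathbb{C}^2 : \eta^{10}=f(\xi)\}$ and $S_{\mathrm{reg}}=S\setminus\{(0,0),(a,0),(b,0)\}$, a smooth connected $1$-dimensional complex submanifold of $\mathbb{C}^2\setminus\{\eta=0\}$. Let $k>0$ be the constant $k=a\big/\int_0^a x^{-4/5}(a-x)^{-3/10}(b-x)^{-9/10}\,dx$. The vector field $X$ is the nowhere vanishing holomorphic vector field on $S_{\mathrm{reg}}$ given by $X(\xi,\eta)=\frac{1}{k}\eta\frac{\partial}{\partial\xi}+\frac{1}{10k}\frac{f'(\xi)}{\eta^{8}}\frac{\partial}{\partial\eta}$.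 The Riemannian metric $\Gamma$ on $S_{\mathrm{reg}}$ is the restriction to $S_{\mathrm{reg}}$ of $\frac{k}{\eta}\,d\xi\odot\frac{k}{\overline{\eta}}\,\overline{d\xi}$; that is, for real tangent vectors $v,w$ to $S_{\mathrm{reg}}$ at $(\xi,\eta)$, $\Gamma(\xi,\eta)(v,w)=\frac{k^2}{|\eta|^2}\,\mathrm{Re}\big(d\xi(v)\,\overline{d\xi(w)}\big)$. Geodesics are affinely parametrized. *)

theory Defs
  imports "HOL-Analysis.Analysis"
begin

section \<open>Smooth maps\<close>

text \<open>\<open>Ck_on k h U\<close> is meant for open \<open>U\<close>: all iterated directional derivatives of order at most \<open>k\<close>
  exist on \<open>U\<close> as derivatives of Frechet-differentiable functions, and those of order \<open>k\<close> are
  continuous. On finite-dimensional spaces this is the usual class \<open>C\<^sup>k\<close>.\<close>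

primrec Ck_on :: "nat \<Rightarrow> ('a::real_normed_vector \<Rightarrow> 'b::real_normed_vector) \<Rightarrow> 'a set \<Rightarrow> bool" where
  "Ck_on 0 h U \<longleftrightarrow> continuous_on U h"
| "Ck_on (Suc k) h U \<longleftrightarrow>
     (\<forall>x\<in>U. h differentiable (at x)) \<and>
     (\<forall>v. Ck_on k (\<lambda>x. frechet_derivative h (at x) v) U)"

definition smooth_on :: "('a::real_normed_vector \<Rightarrow> 'b::real_normed_vector) \<Rightarrow> 'a set \<Rightarrow> bool" where
  "smooth_on h U \<longleftrightarrow> (\<forall>k. Ck_on k h U)"


section \<open>Geodesics on embedded submanifolds\<close>

text \<open>A Riemannian metric on a submanifold \<open>M\<close> of a Euclidean space is given as a function
  \<open>G p v w\<close>; only the values at \<open>p \<in> M\<close> and at tangent vectors \<open>v, w\<close> of \<open>M\<close> at \<open>p\<close>, i.e. vectors in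
  the range of the derivative of a parametrization, are ever used. The dimension of \<open>M\<close> is
  \<open>CARD('n)\<close>.\<close>

definition local_parametrization ::
    "'e::euclidean_space set \<Rightarrow> (real^'n::finite) set \<Rightarrow> (real^'n \<Rightarrow> 'e) \<Rightarrow> bool" where
  "local_parametrization M U \<psi> \<longleftrightarrow>
     open U \<and> smooth_on \<psi> U \<and>
     (\<forall>x\<in>U. inj (frechet_derivative \<psi> (at x))) \<and>
     openin (top_of_set M) (\<psi> ` U) \<and>
     (\<exists>\<kappa>. homeomorphism U (\<psi> ` U) \<psi> \<kappa>)"

definition metric_matrix ::
    "('e::euclidean_space \<Rightarrow> 'e \<Rightarrow> 'e \<Rightarrow> real) \<Rightarrow> (real^'n::finite \<Rightarrow> 'e) \<Rightarrow> real^'n \<Rightarrow> real^'n^'n" where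
  "metric_matrix G \<psi> x =
     (\<chi> i j. G (\<psi> x) (frechet_derivative \<psi> (at x) (axis i 1)) (frechet_derivative \<psi> (at x) (axis j 1)))"

definition metric_partial ::
    "('e::euclidean_space \<Rightarrow> 'e \<Rightarrow> 'e \<Rightarrow> real) \<Rightarrow> (real^'n::finite \<Rightarrow> 'e) \<Rightarrow> real^'n \<Rightarrow> 'n \<Rightarrow> 'n \<Rightarrow> 'n \<Rightarrow> real" where
  "metric_partial G \<psi> x i j l =
     frechet_derivative (\<lambda>y. metric_matrix G \<psi> y $ j $ l) (at x) (axis i 1)"

definition christoffel ::
    "('e::euclidean_space \<Rightarrow> 'e \<Rightarrow> 'e \<Rightarrow> real) \<Rightarrow> (real^'n::finite \<Rightarrow> 'e) \<Rightarrow> real^'n \<Rightarrow> 'n \<Rightarrow> 'n \<Rightarrow> 'n \<Rightarrow> real" where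
  "christoffel G \<psi> x m i j =
     1/2 * (\<Sum>l\<in>UNIV. matrix_inv (metric_matrix G \<psi> x) $ m $ l *
        (metric_partial G \<psi> x i j l + metric_partial G \<psi> x j i l - metric_partial G \<psi> x l i j))"

text \<open>\<open>u\<close> is the expression of the curve \<open>\<gamma>\<close>, restricted to the open set \<open>J\<close> of parameters, in the
  local coordinates given by \<open>\<psi>\<close>.\<close>

definition coordinate_expression ::
    "'e::euclidean_space set \<Rightarrow> (real^'n::finite) set \<Rightarrow> (real^'n \<Rightarrow> 'e) \<Rightarrow>
     (real \<Rightarrow> 'e) \<Rightarrow> real set \<Rightarrow> (real \<Rightarrow> real^'n) \<Rightarrow> bool" where
  "coordinate_expression M U \<psi> \<gamma> J u \<longleftrightarrow>
     local_parametrization M U \<psi> \<and> open J \<and> smooth_on u J \<and>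
     u ` J \<subseteq> U \<and> (\<forall>t\<in>J. \<gamma> t = \<psi> (u t))"

definition geodesic_equation ::
    "('e::euclidean_space \<Rightarrow> 'e \<Rightarrow> 'e \<Rightarrow> real) \<Rightarrow> (real^'n::finite \<Rightarrow> 'e) \<Rightarrow>
     (real \<Rightarrow> real^'n) \<Rightarrow> real \<Rightarrow> bool" where
  "geodesic_equation G \<psi> u t \<longleftrightarrow>
     (\<forall>m. vector_derivative (\<lambda>s. vector_derivative u (at s)) (at t) $ m
          + (\<Sum>i\<in>UNIV. \<Sum>j\<in>UNIV. christoffel G \<psi> (u t) m i j
               * vector_derivative u (at t) $ i * vector_derivative u (at t) $ j) = 0)"

text \<open>The first conjunct says that \<open>\<gamma>\<close> is a smooth curve in the manifold \<open>M\<close> (in particular \<open>M\<close> is a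
  \<open>CARD('n)\<close>-dimensional submanifold near each point of the curve, so that the second conjunct is
  not vacuous); the second one that it satisfies the geodesic equation of \<open>G\<close>, with its given
  parameter as affine parameter, in all local coordinates.\<close>

definition geodesic ::
    "'n::finite itself \<Rightarrow> 'e::euclidean_space set \<Rightarrow> ('e \<Rightarrow> 'e \<Rightarrow> 'e \<Rightarrow> real) \<Rightarrow>
     real set \<Rightarrow> (real \<Rightarrow> 'e) \<Rightarrow> bool" where
  "geodesic (_::'n itself) M G I \<gamma> \<longleftrightarrow>
     (\<forall>t\<in>I. \<exists>(U::(real^'n) set) \<psi> J u. t \<in> J \<and> J \<subseteq> I \<and> coordinate_expression M U \<psi> \<gamma> J u) \<and>
     (\<forall>(U::(real^'n) set) \<psi> J u. J \<subseteq> I \<longrightarrow> coordinate_expression M U \<psi> \<gamma> J u \<longrightarrow>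
        (\<forall>t\<in>J. geodesic_equation G \<psi> u t))"


section \<open>The surface, the vector field and the metric\<close>

definition pt_a :: real where "pt_a = 2 * cos (2 * pi / 5)"

definition pt_b :: real where "pt_b = 2 * cos (pi / 5)"

definition f_poly :: "complex \<Rightarrow> complex" where
  "f_poly \<xi> = \<xi> ^ 8 * (\<xi> - of_real pt_a) ^ 3 * (\<xi> - of_real pt_b) ^ 9"

definition S_curve :: "(complex \<times> complex) set" where
  "S_curve = {(\<xi>, \<eta>). \<eta> ^ 10 = f_poly \<xi>}"

definition S_reg :: "(complex \<times> complex) set" where
  "S_reg = S_curve - {(0, 0), (of_real pt_a, 0), (of_real pt_b, 0)}"

definition k_const :: real where
  "k_const = pt_a / integral {0..pt_a}
     (\<lambda>x. x powr (-4/5) * (pt_a - x) powr (-3/10) * (pt_b - x) powr (-9/10))"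

definition X_field :: "complex \<times> complex \<Rightarrow> complex \<times> complex" where
  "X_field = (\<lambda>(\<xi>, \<eta>).
     (1 / of_real k_const * \<eta>,
      1 / (10 * of_real k_const) * (deriv f_poly \<xi> / \<eta> ^ 8)))"

definition Gamma_metric ::
    "complex \<times> complex \<Rightarrow> complex \<times> complex \<Rightarrow> complex \<times> complex \<Rightarrow> real" where
  "Gamma_metric p v w = k_const\<^sup>2 / (cmod (snd p))\<^sup>2 * Re (fst v * cnj (fst w))"

text \<open>The derivative is the complex one, taken componentwise, so on an open set \<open>\<Omega>\<close> such a \<open>\<phi>\<close> is
  holomorphic.\<close>

definition holomorphic_integral_curve ::
    "(complex \<times> complex \<Rightarrow> complex \<times> complex) \<Rightarrow> (complex \<times> complex) set \<Rightarrow> complex set \<Rightarrow>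
     (complex \<Rightarrow> complex \<times> complex) \<Rightarrow> bool" where
  "holomorphic_integral_curve X M \<Omega> \<phi> \<longleftrightarrow>
     \<phi> ` \<Omega> \<subseteq> M \<and>
     (\<forall>w\<in>\<Omega>. ((\<lambda>z. fst (\<phi> z)) has_field_derivative fst (X (\<phi> w))) (at w) \<and>
             ((\<lambda>z. snd (\<phi> z)) has_field_derivative snd (X (\<phi> w))) (at w))"

end

theory Submission
  imports Defs "HOL-Complex_Analysis.Cauchy_Integral_Formula"
begin

text \<open>The metric is the pullback of the Euclidean metric of \<open>\<complex>\<close> under the holomorphic one-form
  \<open>\<omega> = (k / \<eta>) d\<xi>\<close>, and \<open>\<omega>\<close> is closed, because differentiating \<open>\<eta>\<^sup>1\<^sup>0 = f(\<xi>)\<close> makes \<open>d\<eta>\<close> a multiple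
  of \<open>d\<xi>\<close>. So \<open>\<Gamma>\<close> is flat, with local primitives of \<open>\<omega>\<close> as Euclidean coordinates. The field \<open>X\<close> is
  dual to \<open>\<omega>\<close>, i.e. \<open>\<omega>(X) = 1\<close>, so the velocity of \<open>t \<mapsto> \<phi>(\<alpha> t + w\<^sub>0)\<close> has the constant \<open>\<omega>\<close>-component
  \<open>\<alpha>\<close>: in the flat coordinates the curve is a straight line with constant speed.

  To avoid constructing primitives, the argument is run infinitesimally in an arbitrary chart.
  With \<open>B\<^sub>i\<close> the components of \<open>\<omega>\<close> there, the metric matrix is \<open>B\<^sub>i \<bullet> B\<^sub>j\<close>, closedness is
  \<open>\<partial>\<^sub>j B\<^sub>i = \<partial>\<^sub>i B\<^sub>j\<close>, and differentiating \<open>\<Sum>\<^sub>i u\<^sub>i' B\<^sub>i(u) = \<alpha>\<close> gives the geodesic equation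
  (\<open>metric_flat_coframe_geodesic_equation\<close>, applied to the surface in
  \<open>S_reg_geodesic_equation\<close>). Closedness needs the symmetry of second derivatives
  (\<open>smooth_on_second_derivative_symmetric\<close>). That the curve is smooth in \<open>S_reg\<close>, and that charts
  around it exist, follows from writing \<open>S_reg\<close> locally as the graph of a branch of the tenth root
  of \<open>f\<close> (\<open>S_reg_local_graph\<close>).\<close>


section \<open>Symmetry of second derivatives\<close>

lemma smooth_on_has_derivative:
  "smooth_on h U \<Longrightarrow> x \<in> U \<Longrightarrow> (h has_derivative frechet_derivative h (at x)) (at x)"
  unfolding smooth_on_def by (metis Ck_on.simps(2) frechet_derivative_works)

lemma smooth_on_frechet_derivative:
  "smooth_on h U \<Longrightarrow> smooth_on (\<lambda>x. frechet_derivative h (at x) v) U"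
  unfolding smooth_on_def by (metis Ck_on.simps(2))

lemma smooth_on_imp_continuous_on: "smooth_on h U \<Longrightarrow> continuous_on U h"
  unfolding smooth_on_def by (metis Ck_on.simps(1))

text \<open>The second difference over a parallelogram does not change when its sides \<open>v\<close> and \<open>w\<close> are
  exchanged; expressing it by a value of the \<open>v,w\<close>-derivative is what will make that derivative
  symmetric. The mean value theorem is used once along \<open>v\<close> and once along \<open>w\<close>.\<close>

lemma second_difference_mean_value:
  fixes h :: "'a::real_normed_vector \<Rightarrow> real"
  assumes D: "\<And>y. y \<in> U \<Longrightarrow> (h has_derivative D y) (at y)"
    and DD: "\<And>y. y \<in> U \<Longrightarrow> ((\<lambda>z. D z v) has_derivative DD y) (at y)"
    and "s > 0"
    and U: "\<And>p q. 0 \<le> p \<Longrightarrow> p \<le> s \<Longrightarrow> 0 \<le> q \<Longrightarrow> q \<le> s \<Longrightarrow> x + p *\<^sub>R v + q *\<^sub>R w \<in> U"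
  shows "\<exists>p q. 0 < p \<and> p < s \<and> 0 < q \<and> q < s \<and>
    h (x + s *\<^sub>R v + s *\<^sub>R w) - h (x + s *\<^sub>R v) - h (x + s *\<^sub>R w) + h x
      = s\<^sup>2 * DD (x + p *\<^sub>R v + q *\<^sub>R w) w"
proof -
  have line_v: "DERIV (\<lambda>r. h (x + r *\<^sub>R v + q *\<^sub>R w)) p :> D (x + p *\<^sub>R v + q *\<^sub>R w) v"
    if "0 \<le> p" "p \<le> s" "0 \<le> q" "q \<le> s" for p q
  proof -
    have "((\<lambda>r. h (x + r *\<^sub>R v + q *\<^sub>R w)) has_derivative
             (\<lambda>r. D (x + p *\<^sub>R v + q *\<^sub>R w) (r *\<^sub>R v))) (at p)"
      by (rule has_derivative_compose[where g' = "D (x + p *\<^sub>R v + q *\<^sub>R w)" and f' = "\<lambda>r. r *\<^sub>R v"])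
        (auto intro!: derivative_eq_intros D[OF U[OF that]])
    then show ?thesis
      using linear_scale[OF has_derivative_linear[OF D[OF U[OF that]]]]
      by (simp add: has_field_derivative_def mult_commute_abs)
  qed
  have line_w: "DERIV (\<lambda>r. D (x + p *\<^sub>R v + r *\<^sub>R w) v) q :> DD (x + p *\<^sub>R v + q *\<^sub>R w) w"
    if "0 \<le> p" "p \<le> s" "0 \<le> q" "q \<le> s" for p q
  proof -
    have "((\<lambda>r. D (x + p *\<^sub>R v + r *\<^sub>R w) v) has_derivative
             (\<lambda>r. DD (x + p *\<^sub>R v + q *\<^sub>R w) (r *\<^sub>R w))) (at q)"
      by (rule has_derivative_compose[where g' = "DD (x + p *\<^sub>R v + q *\<^sub>R w)" and f' = "\<lambda>r. r *\<^sub>R w"])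
        (auto intro!: derivative_eq_intros DD[OF U[OF that]])
    then show ?thesis
      using linear_scale[OF has_derivative_linear[OF DD[OF U[OF that]]]]
      by (simp add: has_field_derivative_def mult_commute_abs)
  qed
  have "\<exists>p>0. p < s \<and> (h (x + s *\<^sub>R v + s *\<^sub>R w) - h (x + s *\<^sub>R v + 0 *\<^sub>R w))
       - (h (x + 0 *\<^sub>R v + s *\<^sub>R w) - h (x + 0 *\<^sub>R v + 0 *\<^sub>R w))
     = (s - 0) * (D (x + p *\<^sub>R v + s *\<^sub>R w) v - D (x + p *\<^sub>R v + 0 *\<^sub>R w) v)"
    using \<open>s > 0\<close> by (intro MVT2 DERIV_diff line_v) auto
  then obtain p where p: "0 < p" "p < s" and
    eq1: "h (x + s *\<^sub>R v + s *\<^sub>R w) - h (x + s *\<^sub>R v) - h (x + s *\<^sub>R w) + h x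
     = s * (D (x + p *\<^sub>R v + s *\<^sub>R w) v - D (x + p *\<^sub>R v + 0 *\<^sub>R w) v)"
    by (auto simp: algebra_simps)
  have "\<exists>q>0. q < s \<and> D (x + p *\<^sub>R v + s *\<^sub>R w) v - D (x + p *\<^sub>R v + 0 *\<^sub>R w) v
     = (s - 0) * DD (x + p *\<^sub>R v + q *\<^sub>R w) w"
    using \<open>s > 0\<close> p by (intro MVT2 line_w) auto
  then show ?thesis
    using eq1 p by (metis diff_zero power2_eq_square mult.assoc)
qed

text \<open>Both iterated derivatives represent the same second difference at points that tend to \<open>x\<close> as
  the parallelogram shrinks, so continuity forces them to agree at \<open>x\<close>.\<close>

lemma real_second_derivative_symmetric:
  fixes h :: "'a::real_normed_vector \<Rightarrow> real"
  assumes "open U" "x \<in> U"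
    and D: "\<And>y. y \<in> U \<Longrightarrow> (h has_derivative D y) (at y)"
    and DD: "\<And>v y. y \<in> U \<Longrightarrow> ((\<lambda>z. D z v) has_derivative DD v y) (at y)"
    and cont: "\<And>v w. continuous_on U (\<lambda>y. DD v y w)"
  shows "DD v x w = DD w x v"
proof (rule ccontr)
  assume "DD v x w \<noteq> DD w x v"
  define e where "e = dist (DD v x w) (DD w x v) / 2"
  have "e > 0" using \<open>DD v x w \<noteq> DD w x v\<close> by (simp add: e_def)
  have near: "\<forall>\<^sub>F y in nhds x. dist (DD v' y w') (DD v' x w') < e" for v' w'
  proof -
    have "(\<lambda>y. DD v' y w') \<midarrow>x\<rightarrow> DD v' x w'"
      using cont[of v' w'] \<open>open U\<close> \<open>x \<in> U\<close> by (simp add: continuous_on_eq_continuous_at isCont_def)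
    then show ?thesis
      using tendsto_at_iff_tendsto_nhds[of "\<lambda>y. DD v' y w'" x] tendstoD \<open>e > 0\<close> by blast
  qed
  have "\<forall>\<^sub>F y in nhds x. y \<in> U \<and> dist (DD v y w) (DD v x w) < e \<and> dist (DD w y v) (DD w x v) < e"
    using \<open>open U\<close> \<open>x \<in> U\<close> by (intro eventually_conj near eventually_nhds_in_open)
  then obtain d where "d > 0" and
    d: "\<And>y. dist y x < d \<Longrightarrow> y \<in> U \<and> dist (DD v y w) (DD v x w) < e \<and> dist (DD w y v) (DD w x v) < e"
    unfolding eventually_nhds_metric by blast
  define s where "s = d / (norm v + norm w + 1)"
  have den: "norm v + norm w + 1 > 0" by (smt (verit) norm_ge_zero)
  then have "s > 0" using \<open>d > 0\<close> by (simp add: s_def)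
  have small: "dist (x + p *\<^sub>R v + q *\<^sub>R w) x < d" if "0 \<le> p" "p \<le> s" "0 \<le> q" "q \<le> s" for p q
  proof -
    have "dist (x + p *\<^sub>R v + q *\<^sub>R w) x = norm (p *\<^sub>R v + q *\<^sub>R w)"
      by (simp add: dist_norm algebra_simps)
    also have "\<dots> \<le> p * norm v + q * norm w"
      using that by (metis abs_of_nonneg norm_scaleR norm_triangle_ineq)
    also have "\<dots> \<le> s * norm v + s * norm w"
      using that by (intro add_mono mult_right_mono) auto
    also have "\<dots> < s * (norm v + norm w + 1)"
      using \<open>s > 0\<close> by (simp add: algebra_simps)
    also have "\<dots> = d" using den by (simp add: s_def)
    finally show ?thesis .
  qed
  have small': "dist (x + p *\<^sub>R w + q *\<^sub>R v) x < d" if "0 \<le> p" "p \<le> s" "0 \<le> q" "q \<le> s" for p q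
    using small[OF that(3,4,1,2)] by (simp add: algebra_simps)
  obtain p q where pq: "0 < p" "p < s" "0 < q" "q < s" and
    eq1: "h (x + s *\<^sub>R v + s *\<^sub>R w) - h (x + s *\<^sub>R v) - h (x + s *\<^sub>R w) + h x
      = s\<^sup>2 * DD v (x + p *\<^sub>R v + q *\<^sub>R w) w"
    using second_difference_mean_value[where h = h and U = U and D = D and DD = "DD v", OF D DD \<open>s > 0\<close>]
      d small by blast
  obtain p' q' where pq': "0 < p'" "p' < s" "0 < q'" "q' < s" and
    eq2: "h (x + s *\<^sub>R w + s *\<^sub>R v) - h (x + s *\<^sub>R w) - h (x + s *\<^sub>R v) + h x
      = s\<^sup>2 * DD w (x + p' *\<^sub>R w + q' *\<^sub>R v) v"
    using second_difference_mean_value[where h = h and U = U and D = D and DD = "DD w", OF D DD \<open>s > 0\<close>]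
      d small' by blast
  have "h (x + s *\<^sub>R w + s *\<^sub>R v) = h (x + s *\<^sub>R v + s *\<^sub>R w)" by (simp add: algebra_simps)
  then have "s\<^sup>2 * DD v (x + p *\<^sub>R v + q *\<^sub>R w) w = s\<^sup>2 * DD w (x + p' *\<^sub>R w + q' *\<^sub>R v) v"
    using eq1 eq2 by linarith
  then have eq: "DD v (x + p *\<^sub>R v + q *\<^sub>R w) w = DD w (x + p' *\<^sub>R w + q' *\<^sub>R v) v"
    using \<open>s > 0\<close> by simp
  have "dist (DD v (x + p *\<^sub>R v + q *\<^sub>R w) w) (DD v x w) < dist (DD v x w) (DD w x v) / 2"
    using d small pq by (simp flip: e_def)
  moreover have "dist (DD v (x + p *\<^sub>R v + q *\<^sub>R w) w) (DD w x v) < dist (DD v x w) (DD w x v) / 2"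
    unfolding eq using d small' pq' by (simp flip: e_def)
  ultimately have "dist (DD v x w) (DD w x v) < dist (DD v x w) (DD w x v)"
    by (rule dist_triangle_half_r)
  then show False by simp
qed

lemma smooth_on_second_derivative_symmetric:
  fixes h :: "'a::real_normed_vector \<Rightarrow> 'b::real_inner"
  assumes "smooth_on h U" "open U" "x \<in> U"
  shows "frechet_derivative (\<lambda>y. frechet_derivative h (at y) v) (at x) w
       = frechet_derivative (\<lambda>y. frechet_derivative h (at y) w) (at x) v"
proof -
  have "frechet_derivative (\<lambda>y. frechet_derivative h (at y) v) (at x) w \<bullet> b
      = frechet_derivative (\<lambda>y. frechet_derivative h (at y) w) (at x) v \<bullet> b" for b
    using assms
    by (intro real_second_derivative_symmetric[where h = "\<lambda>y. h y \<bullet> b" and U = U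
          and D = "\<lambda>y v. frechet_derivative h (at y) v \<bullet> b"
          and DD = "\<lambda>v y w. frechet_derivative (\<lambda>y. frechet_derivative h (at y) v) (at y) w \<bullet> b"]
        has_derivative_inner_left continuous_on_inner continuous_on_const
        smooth_on_has_derivative smooth_on_imp_continuous_on smooth_on_frechet_derivative)
  then show ?thesis
    using vector_eq_rdot by blast
qed

section \<open>Geodesics of a metric with a closed coframe\<close>

text \<open>\<open>B\<close> plays the role of the differential of an isometry to a Euclidean space: \<open>metric\<close> says that
  it is isometric, \<open>closed\<close> that it is locally a differential, and \<open>const\<close> that the image of the
  curve has constant velocity. Writing \<open>d i j\<close> for the \<open>j\<close>-th partial derivative of \<open>B i\<close>, closedness
  collapses the Christoffel symbols of the first kind to \<open>d i j \<bullet> B l\<close>, so that the quadratic term of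
  the geodesic equation is the inverse metric applied to the quadratic term in the derivative of
  \<open>const\<close>.\<close>

lemma metric_flat_coframe_geodesic_equation:
  fixes \<psi> :: "real^'n::finite \<Rightarrow> 'e::euclidean_space" and B :: "'n \<Rightarrow> real^'n \<Rightarrow> 'b::real_inner"
  assumes U: "open U" "u t \<in> U"
    and metric: "\<And>y i j. y \<in> U \<Longrightarrow> metric_matrix G \<psi> y $ i $ j = B i y \<bullet> B j y"
    and B': "\<And>i. (B i has_derivative B' i) (at (u t))"
    and closed: "\<And>i j. B' i (axis j 1) = B' j (axis i 1)"
    and indep: "\<And>v :: real^'n. (\<Sum>i\<in>UNIV. v $ i *\<^sub>R B i (u t)) = 0 \<Longrightarrow> v = 0"
    and J: "open J" "t \<in> J" and u: "smooth_on u J"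
    and const: "\<And>s. s \<in> J \<Longrightarrow> (\<Sum>i\<in>UNIV. vector_derivative u (at s) $ i *\<^sub>R B i (u s)) = c"
  shows "geodesic_equation G \<psi> u t"
proof -
  define P where "P = vector_derivative u (at t)"
  define Q where "Q = vector_derivative (\<lambda>s. vector_derivative u (at s)) (at t)"
  define M where "M = metric_matrix G \<psi> (u t)"
  define d where "d i j = B' i (axis j 1)" for i j
  define x where "x = u t"
  have d_sym: "d i j = d j i" for i j
    by (simp add: d_def closed)
  have u_deriv: "(u has_vector_derivative vector_derivative u (at s)) (at s)" if "s \<in> J" for s
    using smooth_on_has_derivative[OF u that] vector_derivative_works differentiableI by blast
  have "vector_derivative u (at s) = frechet_derivative u (at s) 1" if "s \<in> J" for s
    using frechet_derivative_at[OF u_deriv[OF that, unfolded has_vector_derivative_def]]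
    by (metis scaleR_one)
  moreover have "(\<lambda>s. frechet_derivative u (at s) 1) differentiable (at t)"
    using smooth_on_has_derivative[OF smooth_on_frechet_derivative[OF u] J(2)] differentiableI by blast
  ultimately have "(\<lambda>s. vector_derivative u (at s)) differentiable (at t)"
    using J differentiable_def has_derivative_transform_within_open[OF _ J]
    by (metis (no_types, lifting))
  then have Q: "((\<lambda>s. vector_derivative u (at s)) has_vector_derivative Q) (at t)"
    by (simp add: Q_def vector_derivative_works)
  have Q_i: "((\<lambda>s. vector_derivative u (at s) $ i) has_vector_derivative Q $ i) (at t)" for i
    using bounded_linear.has_vector_derivative[OF bounded_linear_vec_nth Q] .
  have B'_expand: "B' i P = (\<Sum>j\<in>UNIV. P $ j *\<^sub>R d i j)" for i
  proof -
    have lin: "linear (B' i)" using B' has_derivative_linear by blast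
    have "B' i P = B' i (\<Sum>j\<in>UNIV. P $ j *\<^sub>R axis j 1)"
      using basis_expansion[of P] by (simp add: scalar_mult_eq_scaleR)
    then show ?thesis
      by (simp add: linear_sum[OF lin] linear_scale[OF lin] d_def)
  qed
  have "((\<lambda>s. B i (u s)) has_vector_derivative B' i P) (at t)" for i
    using vector_derivative_diff_chain_within[OF u_deriv[OF J(2)] has_derivative_at_withinI[OF B']]
    by (simp add: o_def P_def)
  then have "((\<lambda>s. \<Sum>i\<in>UNIV. vector_derivative u (at s) $ i *\<^sub>R B i (u s)) has_vector_derivative
      (\<Sum>i\<in>UNIV. P $ i *\<^sub>R B' i P + Q $ i *\<^sub>R B i x)) (at t)"
    unfolding P_def x_def
    by (intro has_vector_derivative_sum has_vector_derivative_scaleR)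
      (use Q_i in \<open>auto simp: P_def has_real_derivative_iff_has_vector_derivative\<close>)
  moreover have "((\<lambda>s. \<Sum>i\<in>UNIV. vector_derivative u (at s) $ i *\<^sub>R B i (u s)) has_vector_derivative 0) (at t)"
    by (rule has_vector_derivative_transform_within_open[OF has_vector_derivative_const[of c] J])
      (simp add: const)
  ultimately have "(\<Sum>i\<in>UNIV. P $ i *\<^sub>R B' i P + Q $ i *\<^sub>R B i x) = 0"
    using vector_derivative_unique_at by blast
  then have acc: "(\<Sum>i\<in>UNIV. \<Sum>j\<in>UNIV. (P $ i * P $ j) *\<^sub>R d i j) = - (\<Sum>i\<in>UNIV. Q $ i *\<^sub>R B i x)"
    by (simp add: B'_expand sum.distrib scaleR_sum_right eq_neg_iff_add_eq_0)
  \<comment> \<open>In the sum of three metric partials four of the six terms cancel by symmetry of \<open>d\<close>.\<close>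
  have partial: "metric_partial G \<psi> x i j l = d j i \<bullet> B l x + B j x \<bullet> d l i" for i j l
  proof -
    have "((\<lambda>y. B j y \<bullet> B l y) has_derivative (\<lambda>v. B j x \<bullet> B' l v + B' j v \<bullet> B l x)) (at x)"
      unfolding x_def by (intro has_derivative_inner B')
    then have "((\<lambda>y. metric_matrix G \<psi> y $ j $ l) has_derivative
        (\<lambda>v. B j x \<bullet> B' l v + B' j v \<bullet> B l x)) (at x)"
      by (rule has_derivative_transform_within_open[OF _ U(1)]) (simp_all add: U metric x_def)
    from frechet_derivative_at[OF this, symmetric] show ?thesis
      by (simp add: metric_partial_def d_def)
  qed
  have chr: "christoffel G \<psi> x m i j = (\<Sum>l\<in>UNIV. matrix_inv M $ m $ l * (d i j \<bullet> B l x))" for m i j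
  proof -
    have "metric_partial G \<psi> x i j l + metric_partial G \<psi> x j i l - metric_partial G \<psi> x l i j
        = 2 * (d i j \<bullet> B l x)" for l
      unfolding partial using d_sym[of i j] d_sym[of l i] d_sym[of l j]
      by (simp add: inner_commute)
    then show ?thesis
      by (simp add: christoffel_def M_def x_def sum_distrib_left)
  qed
  have M: "M $ i $ j = B i x \<bullet> B j x" for i j
    using metric U by (simp add: M_def x_def)
  have M_inner: "(M *v v) $ l = (\<Sum>i\<in>UNIV. v $ i *\<^sub>R B i x) \<bullet> B l x" for v l
    by (simp add: matrix_vector_mult_def M inner_sum_left inner_commute[of "B l x"] mult.commute)
  have "v = 0" if "M *v v = 0" for v
  proof -
    let ?w = "\<Sum>i\<in>UNIV. v $ i *\<^sub>R B i x"
    have "?w \<bullet> ?w = (\<Sum>l\<in>UNIV. v $ l * (?w \<bullet> B l x))"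
      by (simp only: inner_sum_right inner_scaleR_right)
    also have "\<dots> = 0"
      using that by (simp flip: M_inner)
    finally show "v = 0" using indep by (simp add: x_def)
  qed
  then obtain A where "A ** M = mat 1"
    using matrix_left_invertible_ker[of M] by blast
  then have "M ** A = mat 1 \<and> A ** M = mat 1"
    using matrix_left_right_inverse by blast
  then have inv: "matrix_inv M ** M = mat 1"
    unfolding matrix_inv_def by (rule someI2) blast
  have "(\<Sum>i\<in>UNIV. \<Sum>j\<in>UNIV. christoffel G \<psi> x m i j * P $ i * P $ j) = - Q $ m" for m
  proof -
    have "(\<Sum>i\<in>UNIV. \<Sum>j\<in>UNIV. christoffel G \<psi> x m i j * P $ i * P $ j)
      = (\<Sum>i\<in>UNIV. \<Sum>j\<in>UNIV. \<Sum>l\<in>UNIV. matrix_inv M $ m $ l * (((P $ i * P $ j) *\<^sub>R d i j) \<bullet> B l x))"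
      by (simp add: chr sum_distrib_left sum_distrib_right mult_ac)
    also have "\<dots> = (\<Sum>i\<in>UNIV. \<Sum>l\<in>UNIV. \<Sum>j\<in>UNIV. matrix_inv M $ m $ l * (((P $ i * P $ j) *\<^sub>R d i j) \<bullet> B l x))"
      by (intro sum.cong refl sum.swap)
    also have "\<dots> = (\<Sum>l\<in>UNIV. \<Sum>i\<in>UNIV. \<Sum>j\<in>UNIV. matrix_inv M $ m $ l * (((P $ i * P $ j) *\<^sub>R d i j) \<bullet> B l x))"
      by (rule sum.swap)
    also have "\<dots> = (\<Sum>l\<in>UNIV. matrix_inv M $ m $ l * ((\<Sum>i\<in>UNIV. \<Sum>j\<in>UNIV. (P $ i * P $ j) *\<^sub>R d i j) \<bullet> B l x))"
      by (simp only: inner_sum_left sum_distrib_left)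
    also have "\<dots> = - (\<Sum>l\<in>UNIV. matrix_inv M $ m $ l * (M *v Q) $ l)"
      by (simp add: acc M_inner sum_negf)
    also have "\<dots> = - (matrix_inv M *v (M *v Q)) $ m"
      by (simp add: matrix_vector_mult_def[of "matrix_inv M"])
    also have "\<dots> = - Q $ m"
      by (simp add: matrix_vector_mul_assoc inv)
    finally show ?thesis .
  qed
  then show ?thesis
    unfolding geodesic_equation_def by (simp flip: P_def Q_def x_def)
qed

section \<open>The geodesic equation on the surface\<close>

lemma f_poly_holomorphic: "f_poly holomorphic_on A"
  unfolding f_poly_def by (intro holomorphic_intros)

lemma f_poly_deriv: "(f_poly has_field_derivative deriv f_poly z) (at z)"
  using f_poly_holomorphic[of UNIV] by (simp add: holomorphic_derivI)

lemma S_reg_iff: "p \<in> S_reg \<longleftrightarrow> snd p ^ 10 = f_poly (fst p) \<and> snd p \<noteq> 0"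
  by (cases p) (auto simp: S_reg_def S_curve_def f_poly_def)

text \<open>Differentiating \<open>\<eta>\<^sup>1\<^sup>0 = f(\<xi>)\<close> gives \<open>10 \<eta>\<^sup>9 d\<eta> = f'(\<xi>) d\<xi>\<close> on tangent vectors, and \<open>\<eta>\<close> has no zeros
  on \<open>S_reg\<close>. Hence \<open>d\<xi> \<and> d\<eta> = 0\<close>, which makes \<open>d\<xi> / \<eta>\<close> closed, and \<open>d\<xi>\<close> alone already separates
  tangent vectors.\<close>

lemma
  assumes chart: "local_parametrization S_reg U \<psi>" and y: "y \<in> U"
  shows S_reg_tangent_cross:
      "fst (frechet_derivative \<psi> (at y) v) * snd (frechet_derivative \<psi> (at y) w)
     = fst (frechet_derivative \<psi> (at y) w) * snd (frechet_derivative \<psi> (at y) v)"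
    and S_reg_tangent_fst_eq_0: "fst (frechet_derivative \<psi> (at y) v) = 0 \<Longrightarrow> v = 0"
proof -
  let ?D = "frechet_derivative \<psi> (at y)"
  have S: "\<psi> x \<in> S_reg" if "x \<in> U" for x
    using that chart openin_imp_subset unfolding local_parametrization_def by blast
  have D: "(\<psi> has_derivative ?D) (at y)"
    using chart y smooth_on_has_derivative unfolding local_parametrization_def by blast
  have "((\<lambda>x. snd (\<psi> x) ^ 10) has_derivative (\<lambda>v. 10 * snd (\<psi> y) ^ 9 * snd (?D v))) (at y)"
    by (rule derivative_eq_intros D refl)+ (simp add: fun_eq_iff mult_ac)
  moreover have "((\<lambda>x. f_poly (fst (\<psi> x))) has_derivative (\<lambda>v. deriv f_poly (fst (\<psi> y)) * fst (?D v))) (at y)"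
    by (rule has_derivative_compose[OF has_derivative_fst[OF D]
          f_poly_deriv[unfolded has_field_derivative_def]])
  then have "((\<lambda>x. snd (\<psi> x) ^ 10) has_derivative (\<lambda>v. deriv f_poly (fst (\<psi> y)) * fst (?D v))) (at y)"
    by (rule has_derivative_transform_within_open)
      (use chart y S in \<open>auto simp: local_parametrization_def S_reg_iff\<close>)
  ultimately have *: "10 * snd (\<psi> y) ^ 9 * snd (?D v) = deriv f_poly (fst (\<psi> y)) * fst (?D v)" for v
    using has_derivative_unique by (metis (no_types, lifting))
  have nz: "10 * snd (\<psi> y) ^ 9 \<noteq> 0"
    using S[OF y] by (simp add: S_reg_iff)
  have "10 * snd (\<psi> y) ^ 9 * (fst (?D v) * snd (?D w)) = 10 * snd (\<psi> y) ^ 9 * (fst (?D w) * snd (?D v))"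
    using *[of v] *[of w] by (simp add: algebra_simps)
  then show "fst (?D v) * snd (?D w) = fst (?D w) * snd (?D v)"
    using nz mult_cancel_left by blast
  show "v = 0" if "fst (?D v) = 0"
  proof -
    have "?D v = 0" using *[of v] nz that by (simp add: prod_eq_iff)
    moreover have "?D 0 = 0" using has_derivative_linear[OF D] linear_0 by blast
    moreover have "inj ?D" using chart y unfolding local_parametrization_def by blast
    ultimately show ?thesis by (metis injD)
  qed
qed

lemma constant_geodesic_equation:
  assumes "open J" "t \<in> J" and u: "\<And>s. s \<in> J \<Longrightarrow> (u has_vector_derivative 0) (at s)"
  shows "geodesic_equation G \<psi> u t"
proof -
  have "((\<lambda>s. vector_derivative u (at s)) has_vector_derivative 0) (at t)"
    by (rule has_vector_derivative_transform_within_open[OF has_vector_derivative_const[of 0] assms(1,2)])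
      (simp add: vector_derivative_at[OF u])
  then show ?thesis
    by (simp add: geodesic_equation_def vector_derivative_at vector_derivative_at[OF u[OF assms(2)]])
qed

lemma Gamma_metric_eq_inner:
  "Gamma_metric p v w
     = (of_real k_const * (fst v / snd p)) \<bullet> (of_real k_const * (fst w / snd p))"
proof -
  have inner: "z \<bullet> z' = Re (z * cnj z')" for z z' :: complex
    by (simp add: inner_complex_def)
  have "(of_real k_const * (fst v / snd p)) * cnj (of_real k_const * (fst w / snd p))
      = of_real (k_const\<^sup>2 / (cmod (snd p))\<^sup>2) * (fst v * cnj (fst w))"
    by (simp only: of_real_divide complex_norm_square)
      (simp add: power2_eq_square)
  then show ?thesis
    unfolding inner by (simp only: Gamma_metric_def times_complex.sel Re_complex_of_real Im_complex_of_real mult_zero_left diff_zero)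
qed

text \<open>The coframe is \<open>(k / \<eta>) d\<xi>\<close> in the coordinates of the chart. The velocity of the curve
  is prescribed through its \<open>\<xi>\<close>-component, which determines a tangent vector of the surface.\<close>

lemma S_reg_geodesic_equation:
  fixes \<psi> :: "real^'n::finite \<Rightarrow> complex \<times> complex"
  assumes coords: "coordinate_expression S_reg U \<psi> \<gamma> J u" and t: "t \<in> J"
    and \<gamma>: "\<And>s. s \<in> J \<Longrightarrow>
      ((\<lambda>r. fst (\<gamma> r)) has_vector_derivative \<alpha> * (1 / of_real k_const * snd (\<gamma> s))) (at s)"
  shows "geodesic_equation Gamma_metric \<psi> u t"
proof -
  let ?D = "\<lambda>y. frechet_derivative \<psi> (at y)"
  let ?u' = "\<lambda>s. vector_derivative u (at s)"
  let ?e = "\<lambda>i. axis i 1 :: real^'n"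
  have chart: "local_parametrization S_reg U \<psi>" and J: "open J" and u: "smooth_on u J"
    and uU: "\<And>s. s \<in> J \<Longrightarrow> u s \<in> U" and \<gamma>_eq: "\<And>s. s \<in> J \<Longrightarrow> \<gamma> s = \<psi> (u s)"
    using coords unfolding coordinate_expression_def by auto
  have U: "open U" and \<psi>: "smooth_on \<psi> U"
    using chart unfolding local_parametrization_def by auto
  have nz: "snd (\<psi> y) \<noteq> 0" if "y \<in> U" for y
    using that chart openin_imp_subset S_reg_iff unfolding local_parametrization_def by blast
  have D: "(\<psi> has_derivative ?D y) (at y)" if "y \<in> U" for y
    using smooth_on_has_derivative[OF \<psi> that] .
  have u_deriv: "(u has_vector_derivative ?u' s) (at s)" if "s \<in> J" for s
    using smooth_on_has_derivative[OF u that] vector_derivative_works differentiableI by blast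
  have velocity: "fst (?D (u s) (?u' s)) = \<alpha> * (1 / of_real k_const * snd (\<psi> (u s)))"
    if s: "s \<in> J" for s
  proof -
    have "((\<lambda>r. fst (\<psi> (u r))) has_vector_derivative fst (?D (u s) (?u' s))) (at s)"
      using vector_derivative_diff_chain_within[OF u_deriv[OF s]
          has_derivative_at_withinI[OF has_derivative_fst[OF D[OF uU[OF s]]]]]
      by (simp add: o_def)
    then have "((\<lambda>r. fst (\<gamma> r)) has_vector_derivative fst (?D (u s) (?u' s))) (at s)"
      by (rule has_vector_derivative_transform_within_open[OF _ J s]) (simp add: \<gamma>_eq)
    then show ?thesis
      using vector_derivative_unique_at[OF _ \<gamma>[OF s]] \<gamma>_eq[OF s] by simp
  qed
  show ?thesis
  proof (cases "k_const = 0")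
    \<comment> \<open>By the convention for division by zero, the first component of the velocity vanishes and the
      curve stands still.\<close>
    case True
    then have "?u' s = 0" if "s \<in> J" for s
      using velocity[OF that] S_reg_tangent_fst_eq_0[OF chart uU[OF that]] by simp
    then show ?thesis
      using u_deriv J t by (intro constant_geodesic_equation[of J]) metis+
  next
    case k: False
    define B where "B i y = of_real k_const * (fst (?D y (?e i)) / snd (\<psi> y))" for i y
    \<comment> \<open>The derivative of \<open>B i\<close> by the quotient rule: in direction \<open>j\<close>, its first term is symmetric in
      \<open>i\<close> and \<open>j\<close> as a second derivative of \<open>\<xi>\<close>, its second one because \<open>d\<xi> \<and> d\<eta> = 0\<close>.\<close>
    define B' where "B' i v = of_real k_const *
      (fst (frechet_derivative (\<lambda>y. ?D y (?e i)) (at (u t)) v) / snd (\<psi> (u t))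
        - fst (?D (u t) (?e i)) * snd (?D (u t) v) / (snd (\<psi> (u t)))\<^sup>2)" for i v
    have x: "u t \<in> U" using uU t .
    have sum_B: "(\<Sum>i\<in>UNIV. v $ i *\<^sub>R B i y) = of_real k_const * (fst (?D y v) / snd (\<psi> y))"
      if y: "y \<in> U" for v y
    proof -
      have lin: "linear (\<lambda>v. fst (?D y v))"
        using has_derivative_linear[OF has_derivative_fst[OF D[OF y]]] .
      have "fst (?D y v) = fst (?D y (\<Sum>i\<in>UNIV. v $ i *\<^sub>R ?e i))"
        using basis_expansion[of v] by (simp add: scalar_mult_eq_scaleR)
      also have "\<dots> = (\<Sum>i\<in>UNIV. v $ i *\<^sub>R fst (?D y (?e i)))"
        by (simp only: linear_sum[OF lin] linear_scale[OF lin])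
      finally show ?thesis
        by (simp add: B_def sum_distrib_left sum_divide_distrib scaleR_conv_of_real mult_ac)
    qed
    show ?thesis
    proof (rule metric_flat_coframe_geodesic_equation[where u = u and t = t, OF U x])
      show "metric_matrix Gamma_metric \<psi> y $ i $ j = B i y \<bullet> B j y" if "y \<in> U" for y i j
        by (simp add: metric_matrix_def Gamma_metric_eq_inner B_def)
      show "(B i has_derivative B' i) (at (u t))" for i
        unfolding B_def[abs_def] B'_def[abs_def]
        using nz[OF x] D[OF x] smooth_on_has_derivative[OF smooth_on_frechet_derivative[OF \<psi>] x, of "?e i"]
        by (auto intro!: derivative_eq_intros simp: fun_eq_iff field_simps power2_eq_square)
      show "B' i (?e j) = B' j (?e i)" for i j
        unfolding B'_def S_reg_tangent_cross[OF chart x, of "?e i" "?e j"]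
          smooth_on_second_derivative_symmetric[OF \<psi> U x, of "?e i" "?e j"] ..
      show "v = 0" if "(\<Sum>i\<in>UNIV. v $ i *\<^sub>R B i (u t)) = 0" for v
        using that k nz[OF x] S_reg_tangent_fst_eq_0[OF chart x] by (simp add: sum_B[OF x])
      show "(\<Sum>i\<in>UNIV. ?u' s $ i *\<^sub>R B i (u s)) = \<alpha>" if "s \<in> J" for s
        using velocity[OF that] k nz[OF uU[OF that]] by (simp add: sum_B[OF uU[OF that]])
    qed (use J t u in auto)
  qed
qed



section \<open>Charts of the surface as graphs\<close>

lemma Ck_on_cong:
  assumes "open U" "\<And>x. x \<in> U \<Longrightarrow> h x = h' x"
  shows "Ck_on k h U \<Longrightarrow> Ck_on k h' U"
  using assms(2)
proof (induction k arbitrary: h h')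
  case 0
  then show ?case using continuous_on_cong[of U U h h'] by simp
next
  case (Suc k)
  have D: "(h' has_derivative frechet_derivative h (at x)) (at x)" if "x \<in> U" for x
  proof (rule has_derivative_transform_within_open[OF _ assms(1) that])
    show "(h has_derivative frechet_derivative h (at x)) (at x)"
      using Suc.prems(1) that by (simp flip: frechet_derivative_works)
  qed (rule Suc.prems(2))
  have "Ck_on k (\<lambda>x. frechet_derivative h' (at x) v) U" for v
  proof (rule Suc.IH)
    show "Ck_on k (\<lambda>x. frechet_derivative h (at x) v) U"
      using Suc.prems(1) by simp
  qed (simp only: frechet_derivative_at[OF D, symmetric])
  then show ?case unfolding Ck_on.simps differentiable_def using D by blast
qed

text \<open>The directional derivatives of \<open>P (g (L x), h (L x))\<close> have the same form again, with \<open>g\<close> and \<open>h\<close>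
  replaced by their complex derivatives and \<open>P\<close> precomposed with a multiplication; this closes the
  induction over the order. With \<open>L\<close> the identification of the plane with \<open>\<complex>\<close> it covers graphs of
  holomorphic functions, with \<open>L\<close> the inclusion of \<open>\<real>\<close> in \<open>\<complex>\<close> it covers curves in real time.\<close>

lemma smooth_on_holomorphic_pair:
  fixes L :: "'a::real_normed_vector \<Rightarrow> complex" and P :: "complex \<times> complex \<Rightarrow> 'b::real_normed_vector"
  assumes U: "open U" and W: "open W" and L: "bounded_linear L" and LU: "L ` U \<subseteq> W"
    and "bounded_linear P" "g holomorphic_on W" "h holomorphic_on W"
  shows "smooth_on (\<lambda>x. P (g (L x), h (L x))) U"
  unfolding smooth_on_def
proof
  fix k
  show "Ck_on k (\<lambda>x. P (g (L x), h (L x))) U"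
    using assms(5-7)
  proof (induction k arbitrary: P g h)
    case 0
    have "continuous_on U L" using L by (rule bounded_linear.continuous_on) (rule continuous_on_id)
    then have "continuous_on U (\<lambda>x. (g (L x), h (L x)))"
      using continuous_on_compose2[OF holomorphic_on_imp_continuous_on[OF 0(2)] _ LU]
        continuous_on_compose2[OF holomorphic_on_imp_continuous_on[OF 0(3)] _ LU]
      by (intro continuous_on_Pair) blast+
    then have "continuous_on U (\<lambda>x. P (g (L x), h (L x)))" by (rule bounded_linear.continuous_on[OF 0(1)])
    then show ?case by simp
  next
    case (Suc k)
    let ?P' = "\<lambda>v p. P (fst p * L v, snd p * L v)"
    have D: "((\<lambda>x. P (g (L x), h (L x))) has_derivative (\<lambda>v. ?P' v (deriv g (L x), deriv h (L x)))) (at x)"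
      if x: "x \<in> U" for x
    proof -
      have Lx: "(L has_derivative L) (at x)" using L by (rule bounded_linear_imp_has_derivative)
      have "((\<lambda>x. F (L x)) has_derivative (\<lambda>v. deriv F (L x) * L v)) (at x)"
        if "F holomorphic_on W" for F
      proof (rule has_derivative_compose[OF Lx, where g = F])
        have "L x \<in> W" using x LU by blast
        then show "(F has_derivative (*) (deriv F (L x))) (at (L x))"
          using holomorphic_derivI[OF that W] by (simp add: has_field_derivative_def)
      qed
      then show ?thesis
        using Suc.prems
        by (intro bounded_linear.has_derivative[OF Suc.prems(1)] has_derivative_Pair) auto
    qed
    have "Ck_on k (\<lambda>x. frechet_derivative (\<lambda>x. P (g (L x), h (L x))) (at x) v) U" for v
    proof (rule Ck_on_cong[OF U])
      have "bounded_linear (\<lambda>p::complex \<times> complex. (fst p * L v, snd p * L v))"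
        by (intro bounded_linear_intros)
      then have "bounded_linear (?P' v)"
        by (rule bounded_linear_compose[OF Suc.prems(1)])
      then show "Ck_on k (\<lambda>x. ?P' v (deriv g (L x), deriv h (L x))) U"
        using Suc.prems W by (intro Suc.IH holomorphic_deriv)
      show "?P' v (deriv g (L x), deriv h (L x)) = frechet_derivative (\<lambda>x. P (g (L x), h (L x))) (at x) v"
        if "x \<in> U" for x
        by (simp only: frechet_derivative_at[OF D[OF that], symmetric])
    qed
    then show ?case unfolding Ck_on.simps differentiable_def using D by blast
  qed
qed

text \<open>Near \<open>p\<close> the function \<open>f\<close> has a holomorphic tenth root \<open>g\<close> through \<open>p\<close>, built from the principal
  logarithm of \<open>f / f(fst p)\<close>. The other points of \<open>S_reg\<close> over the same \<open>\<xi>\<close> differ from it by a nontrivial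
  tenth root of unity; there are finitely many of these, so excluding them is an open condition on
  the quotient \<open>\<eta> / g(\<xi>)\<close>.\<close>

lemma S_reg_local_graph:
  assumes p: "p \<in> S_reg"
  obtains W g N where "open W" "fst p \<in> W" "g holomorphic_on W" "open N" "p \<in> N"
    "S_reg \<inter> N = (\<lambda>z. (z, g z)) ` W"
proof
  define r where "r z = f_poly z / f_poly (fst p)" for z
  define W where "W = {z. 0 < Re (r z)}"
  define g where "g z = snd p * exp (Ln (r z) / 10)" for z
  define T where "T = {\<zeta>::complex. \<zeta> ^ 10 = 1} - {1}"
  define N where "N = (W \<times> UNIV) \<inter> (\<lambda>q. snd q / g (fst q)) -` (- T)"
  have fp: "f_poly (fst p) = snd p ^ 10" and nz: "snd p \<noteq> 0"
    using p by (simp_all add: S_reg_iff)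
  have r_hol: "r holomorphic_on A" for A
    unfolding r_def[abs_def] by (intro holomorphic_intros f_poly_holomorphic) (simp add: fp nz)
  have r_p: "r (fst p) = 1" by (simp add: r_def fp nz)
  show W: "open W"
    unfolding W_def using holomorphic_on_imp_continuous_on[OF r_hol]
    by (intro open_Collect_less continuous_intros)
  show p_W: "fst p \<in> W" by (simp add: W_def r_p)
  show g_hol: "g holomorphic_on W"
    unfolding g_def[abs_def]
    by (intro holomorphic_intros r_hol) (auto simp: W_def complex_nonpos_Reals_iff)
  have g_nz: "g z \<noteq> 0" for z by (simp add: g_def nz)
  have g_pow: "g z ^ 10 = f_poly z" if "z \<in> W" for z
  proof -
    have "r z \<noteq> 0" using that by (auto simp: W_def)
    then have "exp (Ln (r z) / 10) ^ 10 = r z"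
      by (simp flip: exp_of_nat_mult)
    then show ?thesis by (simp add: g_def power_mult_distrib r_def fp nz)
  qed
  have "continuous_on (W \<times> UNIV) (\<lambda>q. g (fst q))"
    by (rule continuous_on_compose2[OF holomorphic_on_imp_continuous_on[OF g_hol]
          continuous_on_fst[OF continuous_on_id]]) auto
  then have "continuous_on (W \<times> UNIV) (\<lambda>q. snd q / g (fst q))"
    using g_nz by (intro continuous_intros) auto
  moreover have "finite T" unfolding T_def by (intro finite_Diff finite_roots_unity) simp
  ultimately show "open N"
    unfolding N_def using W
    by (intro continuous_open_preimage open_Times open_Compl finite_imp_closed) auto
  show "p \<in> N" using p_W nz by (simp add: N_def T_def g_def r_p mem_Times_iff)
  show "S_reg \<inter> N = (\<lambda>z. (z, g z)) ` W"
  proof (intro equalityI subsetI)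
    fix q assume q: "q \<in> S_reg \<inter> N"
    then have "fst q \<in> W" by (auto simp: N_def)
    moreover have "snd q ^ 10 = g (fst q) ^ 10"
      using q g_pow[OF \<open>fst q \<in> W\<close>] by (simp add: S_reg_iff)
    then have "(snd q / g (fst q)) ^ 10 = 1"
      by (simp add: power_divide g_nz)
    then have "snd q / g (fst q) = 1" using q by (auto simp: N_def T_def)
    then have "snd q = g (fst q)" by simp
    ultimately show "q \<in> (\<lambda>z. (z, g z)) ` W" by (intro image_eqI[of _ _ "fst q"]) (simp_all add: prod_eq_iff)
  next
    fix q assume "q \<in> (\<lambda>z. (z, g z)) ` W"
    then show "q \<in> S_reg \<inter> N" using g_pow g_nz by (auto simp: N_def T_def S_reg_iff)
  qed
qed

section \<open>Integral curves are geodesics\<close>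

theorem claim3p2:
  fixes \<phi> :: "complex \<Rightarrow> complex \<times> complex"
    and \<Omega> :: "complex set"
    and \<alpha> w\<^sub>0 :: complex
    and I :: "real set"
  assumes "open \<Omega>" and "connected \<Omega>"
    and "holomorphic_integral_curve X_field S_reg \<Omega> \<phi>"
    and "\<alpha> \<noteq> 0"
    and "open I" and "is_interval I"
    and "\<And>t. t \<in> I \<Longrightarrow> \<alpha> * of_real t + w\<^sub>0 \<in> \<Omega>"
  shows "geodesic TYPE(2) S_reg Gamma_metric I (\<lambda>t. \<phi> (\<alpha> * of_real t + w\<^sub>0))"
proof -
  define \<gamma> where "\<gamma> t = \<phi> (\<alpha> * of_real t + w\<^sub>0)" for t
  have \<gamma>_S: "\<gamma> t \<in> S_reg" if "t \<in> I" for t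
    using assms(3,7) that unfolding \<gamma>_def holomorphic_integral_curve_def by blast
  have \<phi>1: "((\<lambda>z. fst (\<phi> z)) has_field_derivative 1 / of_real k_const * snd (\<phi> w)) (at w)"
    and \<phi>2: "(\<lambda>z. snd (\<phi> z)) field_differentiable (at w)" if "w \<in> \<Omega>" for w
    using assms(3) that unfolding holomorphic_integral_curve_def X_field_def
    by (auto simp: split_beta field_differentiable_def)
  have \<phi>1_hol: "(\<lambda>z. fst (\<phi> z)) holomorphic_on \<Omega>" and \<phi>2_hol: "(\<lambda>z. snd (\<phi> z)) holomorphic_on \<Omega>"
    unfolding holomorphic_on_def field_differentiable_def
    using \<phi>1 \<phi>2[unfolded field_differentiable_def] has_field_derivative_at_within by blast+
  have \<phi>_cont: "continuous_on \<Omega> \<phi>"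
    using continuous_on_Pair[OF \<phi>1_hol[THEN holomorphic_on_imp_continuous_on] \<phi>2_hol[THEN holomorphic_on_imp_continuous_on]]
    by simp
  have line: "((\<lambda>r. \<alpha> * of_real r + w\<^sub>0) has_vector_derivative \<alpha>) (at t)" for t
    by (auto intro!: derivative_eq_intros)
  have \<gamma>1: "((\<lambda>r. fst (\<gamma> r)) has_vector_derivative \<alpha> * (1 / of_real k_const * snd (\<gamma> t))) (at t)"
    if "t \<in> I" for t
    using field_vector_diff_chain_at[OF line \<phi>1[OF assms(7)[OF that]]] by (simp add: o_def \<gamma>_def)
  have equation: "geodesic_equation Gamma_metric \<psi> u t"
    if "J \<subseteq> I" "coordinate_expression S_reg U \<psi> \<gamma> J u" "t \<in> J" for U :: "(real^2) set" and \<psi> J u t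
    using that \<gamma>1 by (intro S_reg_geodesic_equation[OF that(2,3)]) auto
  have local: "\<exists>(U :: (real^2) set) \<psi> J u. t \<in> J \<and> J \<subseteq> I \<and> coordinate_expression S_reg U \<psi> \<gamma> J u"
    if t: "t \<in> I" for t
  proof -
    obtain W g N where W: "open W" and g: "g holomorphic_on W" and N: "open N" "\<gamma> t \<in> N"
      and graph: "S_reg \<inter> N = (\<lambda>z. (z, g z)) ` W"
      using S_reg_local_graph[OF \<gamma>_S[OF t]] by metis
    define L :: "real^2 \<Rightarrow> complex" where "L x = Complex (x $ 1) (x $ 2)" for x
    define K :: "complex \<Rightarrow> real^2" where "K z = vector [Re z, Im z]" for z
    define U where "U = L -` W"
    define \<psi> where "\<psi> x = (L x, g (L x))" for x
    define J where "J = I \<inter> \<gamma> -` N"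
    define u where "u s = K (fst (\<gamma> s))" for s
    have LK: "L (K z) = z" for z by (simp add: L_def K_def)
    have KL: "K (L x) = x" for x
      by (simp add: L_def K_def vec_eq_iff forall_2)
    have L: "bounded_linear L"
      unfolding L_def[abs_def] by (intro linear_conv_bounded_linear[THEN iffD1] linearI) (simp_all add: complex_eq_iff)
    have K: "bounded_linear K"
      unfolding K_def[abs_def] by (intro linear_conv_bounded_linear[THEN iffD1] linearI) (simp_all add: vec_eq_iff forall_2)
    have contL: "continuous_on A L" and contK: "continuous_on B K" for A B
      using L K linear_continuous_on by auto
    have U: "open U" unfolding U_def using contL W by (rule open_vimage[rotated])
    have \<psi>_smooth: "smooth_on \<psi> U"
      unfolding \<psi>_def[abs_def]
      using smooth_on_holomorphic_pair[OF U W L, of id "\<lambda>z. z" g] g by (simp add: U_def id_def)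
    have image: "\<psi> ` U = S_reg \<inter> N"
      using surj_image_vimage_eq[OF surjI[of L, OF LK], of W]
      by (simp add: graph U_def \<psi>_def[abs_def] flip: image_image[of "\<lambda>z. (z, g z)" L])
    have inj: "inj (frechet_derivative \<psi> (at x))" if "x \<in> U" for x
    proof (rule injI)
      fix v w assume eq: "frechet_derivative \<psi> (at x) v = frechet_derivative \<psi> (at x) w"
      have "((\<lambda>y. fst (\<psi> y)) has_derivative (\<lambda>v. fst (frechet_derivative \<psi> (at x) v))) (at x)"
        by (intro has_derivative_fst smooth_on_has_derivative[OF \<psi>_smooth that])
      moreover have "((\<lambda>y. fst (\<psi> y)) has_derivative L) (at x)"
        using L by (simp add: \<psi>_def bounded_linear_imp_has_derivative)
      ultimately have "(\<lambda>v. fst (frechet_derivative \<psi> (at x) v)) = L"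
        by (rule has_derivative_unique)
      then have "L v = L w" using eq by metis
      then show "v = w" by (metis KL)
    qed
    have "homeomorphism U (\<psi> ` U) \<psi> (\<lambda>p. K (fst p))"
      unfolding homeomorphism_def using smooth_on_imp_continuous_on[OF \<psi>_smooth]
        continuous_on_compose2[OF contK continuous_on_fst[OF continuous_on_id]]
      by (auto simp: \<psi>_def KL image_image)
    then have chart: "local_parametrization S_reg U \<psi>"
      unfolding local_parametrization_def using U \<psi>_smooth inj N by (auto simp: image openin_open)
    have "continuous_on I \<gamma>"
      unfolding \<gamma>_def[abs_def] using assms(7)
      by (intro continuous_on_compose2[OF \<phi>_cont, where f = "\<lambda>t. \<alpha> * of_real t + w\<^sub>0"] continuous_intros) auto
    then have J: "open J" unfolding J_def using assms(5) N(1) by (rule continuous_open_preimage)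
    have u_chart: "u s \<in> U \<and> \<gamma> s = \<psi> (u s)" if "s \<in> J" for s
    proof -
      have "\<gamma> s \<in> \<psi> ` U"
        using that \<gamma>_S by (simp add: image J_def)
      then obtain x where "x \<in> U" "\<gamma> s = \<psi> x" by blast
      moreover from this have "u s = x" by (simp add: u_def \<psi>_def KL)
      ultimately show ?thesis by simp
    qed
    \<comment> \<open>\<open>u\<close> is a holomorphic function restricted to real time, hence smooth.\<close>
    have "smooth_on u J"
    proof -
      let ?A = "\<lambda>z. \<alpha> * z + w\<^sub>0"
      have "open (?A -` \<Omega>)"
        by (intro open_vimage assms(1) continuous_intros)
      moreover have "(\<lambda>z. fst (\<phi> (?A z))) holomorphic_on (?A -` \<Omega>)"
      proof -
        have "?A holomorphic_on (?A -` \<Omega>)" by (intro holomorphic_intros)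
        then show ?thesis
          using holomorphic_on_compose_gen[OF _ \<phi>1_hol, of ?A "?A -` \<Omega>"] by (simp add: o_def)
      qed
      moreover have "bounded_linear (\<lambda>p::complex \<times> complex. K (fst p))"
        using bounded_linear_compose[OF K bounded_linear_fst] .
      ultimately show ?thesis
        using smooth_on_holomorphic_pair[OF J _ bounded_linear_of_real, of "?A -` \<Omega>" "\<lambda>p. K (fst p)"
            "\<lambda>z. fst (\<phi> (?A z))" "\<lambda>z. z"] assms(7)
        by (auto simp: u_def[abs_def] \<gamma>_def J_def)
    qed
    then have "coordinate_expression S_reg U \<psi> \<gamma> J u"
      unfolding coordinate_expression_def image_subset_iff
      by (intro conjI ballI chart J u_chart[THEN conjunct1] u_chart[THEN conjunct2])
    moreover have "t \<in> J" "J \<subseteq> I" using t N(2) by (auto simp: J_def)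
    ultimately show ?thesis by blast
  qed
  show ?thesis
    unfolding geodesic_def \<gamma>_def[symmetric] using local equation by blast
qed

end
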